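(* Let $r^o=\sup_{u\in\mathcal U}\|\hat\beta(u)-\beta(u)\|$. If $\inf_{u\in\mathcal U}\min_{j\in T_u}|\beta_j(u)|>r^o$, then $$T_u:=\mathrm{support}(\beta(u))\subseteq\widehat T_u:=\mathrm{support}(\hat\beta(u))\quad\text{for all }u\in\mathcal U.$$ Moreover, for $\gamma\ge0$ define the hard-thresholded estimator $\bar\beta(u)$ by $$\bar\beta_j(u)=\hat\beta_j(u)\,1\{|\hat\beta_j(u)|>\gamma\},\quad u\in\mathcal U,\ j=1,\dots,p.$$ If $\gamma$ is chosen such that $r^o<\gamma<\inf_{u\in\mathcal U}\min_{j\in T_u}|\beta_j(u)|-r^o$, then $$\mathrm{support}(\bar\beta(u))=T_u\quad\text{for all }u\in\mathcal U.$$
   Context: $\mathcal U\subset(0,1)$ is a compact set of quantile indices; $\beta(u)\in\mathbb R^p$, $u\in\mathcal U$, are the true quantile regression coefficients, i.e. the $u$-th conditional quantile of $y_i$ given $x_i$ is $x_i'\beta(u)$. Given a sample $(y_i,x_i)_{i\le n}$ and a penalty level $\lambda$, $\hat\beta(u)$ is the $\ell_1$-penalized quantile regression estimator, a minimizer over $\beta\in\mathbb R^p$ of $\frac1n\sum_{i=1}^n\rho_u(y_i-x_i'\beta)+\frac{\lambda\sqrt{u(1-u)}}n\sum_{j=1}^p\hat\sigma_j|\beta_j|$, where $\rho_u(t)=(u-1\{t\le0\})t$ and $\hat\sigma_j^2=\frac1n\sum_ix_{ij}^2$. $\|\cdot\|$ is the Euclidean norm and $\mathrm{support}(b)=\{j:|b_j|>0\}$.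 (The symbol $\gamma$ here is the threshold.) *)

theory Defs
  imports "HOL-Probability.Probability"
begin

text \<open>A regular conditional distribution of \<open>Y\<close> given \<open>X\<close>; for real-valued \<open>Y\<close> it exists and is
  unique up to null sets of the law of \<open>X\<close>.\<close>

definition cond_distribution ::
  "'w measure \<Rightarrow> ('w \<Rightarrow> 'b::topological_space) \<Rightarrow> ('w \<Rightarrow> real) \<Rightarrow> ('b \<Rightarrow> real measure) \<Rightarrow> bool"
  where "cond_distribution M X Y K \<longleftrightarrow>
    K \<in> borel \<rightarrow>\<^sub>M prob_algebra borel \<and>
    (\<forall>A\<in>sets borel. \<forall>B\<in>sets borel.
       measure M {\<omega> \<in> space M. X \<omega> \<in> A \<and> Y \<omega> \<in> B}
         = (LINT \<omega>|M. indicator A (X \<omega>) * measure (K (X \<omega>)) B))"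

text \<open>The \<open>u\<close>-th conditional quantile of \<open>Y\<close> given \<open>X\<close> is \<open>q X\<close>, almost surely: the quantile is the
  left-continuous inverse of the conditional distribution function.\<close>

definition is_cond_quantile ::
  "'w measure \<Rightarrow> ('w \<Rightarrow> 'b::topological_space) \<Rightarrow> ('w \<Rightarrow> real) \<Rightarrow> real \<Rightarrow> ('b \<Rightarrow> real) \<Rightarrow> bool"
  where "is_cond_quantile M X Y u q \<longleftrightarrow>
    (\<exists>K. cond_distribution M X Y K \<and>
         (AE \<omega> in M. q (X \<omega>) = Inf {t. u \<le> cdf (K (X \<omega>)) t}))"

definition check_loss :: "real \<Rightarrow> real \<Rightarrow> real"
  where "check_loss u t = (u - of_bool (t \<le> 0)) * t"

definition sigma_hat :: "nat \<Rightarrow> (nat \<Rightarrow> real ^ 'p) \<Rightarrow> 'p::finite \<Rightarrow> real"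
  where "sigma_hat n x j = sqrt (1 / real n * (\<Sum>i=1..n. (x i $ j)\<^sup>2))"

definition penalized_objective ::
  "nat \<Rightarrow> (nat \<Rightarrow> real) \<Rightarrow> (nat \<Rightarrow> real ^ 'p::finite) \<Rightarrow> real \<Rightarrow> real \<Rightarrow> real ^ 'p \<Rightarrow> real"
  where "penalized_objective n y x lam u b =
    1 / real n * (\<Sum>i=1..n. check_loss u (y i - x i \<bullet> b))
    + lam * sqrt (u * (1 - u)) / real n * (\<Sum>j\<in>UNIV. sigma_hat n x j * \<bar>b $ j\<bar>)"

text \<open>Minimizers need not be unique; any of them is an estimate.\<close>

definition is_l1_qr_estimate ::
  "nat \<Rightarrow> (nat \<Rightarrow> real) \<Rightarrow> (nat \<Rightarrow> real ^ 'p::finite) \<Rightarrow> real \<Rightarrow> real \<Rightarrow> real ^ 'p \<Rightarrow> bool"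
  where "is_l1_qr_estimate n y x lam u b \<longleftrightarrow>
    is_arg_min (penalized_objective n y x lam u) (\<lambda>_. True) b"

definition support :: "real ^ 'p::finite \<Rightarrow> 'p set"
  where "support b = {j. \<bar>b $ j\<bar> > 0}"

definition hard_threshold :: "real \<Rightarrow> real ^ 'p::finite \<Rightarrow> real ^ 'p"
  where "hard_threshold \<gamma> b = (\<chi> j. b $ j * of_bool (\<bar>b $ j\<bar> > \<gamma>))"

text \<open>Suprema and infima over \<open>U\<close> are taken in the extended reals, since neither boundedness of
  the coefficient errors nor nonemptiness of the supports is assumed.\<close>

definition sup_error :: "real set \<Rightarrow> (real \<Rightarrow> real ^ 'p::finite) \<Rightarrow> (real \<Rightarrow> real ^ 'p) \<Rightarrow> ereal"
  where "sup_error U \<beta>hat \<beta> = (SUP u\<in>U. ereal (norm (\<beta>hat u - \<beta> u)))"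

text \<open>The inner infimum runs over a finite set: it is the minimum if \<open>support (\<beta> u)\<close> is nonempty,
  and \<open>\<infinity>\<close> otherwise.\<close>

definition min_signal :: "real set \<Rightarrow> (real \<Rightarrow> real ^ 'p::finite) \<Rightarrow> ereal"
  where "min_signal U \<beta> = (INF u\<in>U. INF j\<in>support (\<beta> u). ereal \<bar>\<beta> u $ j\<bar>)"

end

theory Submission
  imports Defs
begin

text \<open>The argument is deterministic and coordinatewise. Each coordinate of \<beta>hat u is
  within the uniform error r of that of \<beta> u (\<open>coefficient_error_le_sup_error\<close>),
  while each nonzero coordinate of \<beta> u is at least the minimal signal in modulus
  (\<open>min_signal_le\<close>). If the signal exceeds r, no nonzero coefficient can be estimated
  by zero. If r < \<gamma> < signal - r, the threshold separates the two groups: estimates on the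
  support exceed \<gamma> in modulus, those off it stay at most r, hence below \<gamma>.\<close>

lemma coefficient_error_le_sup_error:
  assumes "u \<in> U"
  shows "ereal \<bar>\<beta>hat u $ j - \<beta> u $ j\<bar> \<le> sup_error U \<beta>hat \<beta>"
proof -
  have "\<bar>\<beta>hat u $ j - \<beta> u $ j\<bar> \<le> norm (\<beta>hat u - \<beta> u)"
    using component_le_norm_cart[of "\<beta>hat u - \<beta> u" j] by simp
  also have "ereal (norm (\<beta>hat u - \<beta> u)) \<le> sup_error U \<beta>hat \<beta>"
    unfolding sup_error_def using assms by (rule SUP_upper)
  finally show ?thesis by simp
qed

lemma min_signal_le:
  assumes "u \<in> U" and "j \<in> support (\<beta> u)"
  shows "min_signal U \<beta> \<le> ereal \<bar>\<beta> u $ j\<bar>"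
  unfolding min_signal_def
  using assms by (meson INF_lower order_trans)

lemma support_subset_support_estimate:
  assumes "sup_error U \<beta>hat \<beta> < min_signal U \<beta>" and "u \<in> U"
  shows "support (\<beta> u) \<subseteq> support (\<beta>hat u)"
proof
  fix j assume "j \<in> support (\<beta> u)"
  then have "ereal \<bar>\<beta>hat u $ j - \<beta> u $ j\<bar> < ereal \<bar>\<beta> u $ j\<bar>"
    using coefficient_error_le_sup_error[OF assms(2)] min_signal_le[OF assms(2)] assms(1)
    by (meson le_less_trans less_le_trans)
  \<comment> \<open>A vanishing estimate would have error exactly \<bar>\<beta> u $ j\<bar>, against
    the strict bound.\<close>
  then show "j \<in> support (\<beta>hat u)"
    by (auto simp: support_def)
qed

text \<open>With \<gamma> nonnegative, every coordinate that survives the threshold is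
  nonzero.\<close>

lemma support_hard_threshold:
  assumes "\<gamma> \<ge> 0"
  shows "support (hard_threshold \<gamma> b) = {j. \<bar>b $ j\<bar> > \<gamma>}"
  using assms by (auto simp: support_def hard_threshold_def)

lemma support_hard_threshold_estimate:
  assumes "\<gamma> \<ge> 0"
    and err: "sup_error U \<beta>hat \<beta> < ereal \<gamma>"
    and sig: "ereal \<gamma> < min_signal U \<beta> - sup_error U \<beta>hat \<beta>"
    and "u \<in> U"
  shows "support (hard_threshold \<gamma> (\<beta>hat u)) = support (\<beta> u)"
proof -
  note le_err = coefficient_error_le_sup_error[OF \<open>u \<in> U\<close>, of \<beta>hat _ \<beta>]
  \<comment> \<open>The supremum is finite: \<open>err\<close> rules out \<infinity>, and since u
    lies in U it dominates a real number, which rules out -\<infinity>. Subtraction of it is then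
    ordinary.\<close>
  obtain r where r: "sup_error U \<beta>hat \<beta> = ereal r"
    using err le_err by (cases "sup_error U \<beta>hat \<beta>") auto
  have above: "\<gamma> < \<bar>\<beta>hat u $ j\<bar>" if "j \<in> support (\<beta> u)" for j
  proof -
    \<comment> \<open>Passing from \<open>min_signal\<close> to one coefficient makes both terms
      real; the reverse triangle inequality then finishes.\<close>
    have "ereal \<gamma> < ereal \<bar>\<beta> u $ j\<bar> - ereal r"
      using sig ereal_minus_mono[OF min_signal_le[where \<beta> = \<beta>, OF \<open>u \<in> U\<close> that] order_refl]
      unfolding r by (rule less_le_trans)
    then show ?thesis
      using le_err[of j] by (simp add: r)
  qed
  \<comment> \<open>Here the true coefficient is 0, so the estimate is itself the error.\<close>
  have below: "\<bar>\<beta>hat u $ j\<bar> < \<gamma>" if "j \<notin> support (\<beta> u)" for j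
    using that le_err[of j] err by (simp add: r support_def)
  show ?thesis
    unfolding support_hard_threshold[OF \<open>\<gamma> \<ge> 0\<close>] using above below by force
qed

theorem theorem4:
  fixes M :: "'w measure"
    and U :: "real set"
    and n :: nat
    and y :: "nat \<Rightarrow> 'w \<Rightarrow> real"
    and x :: "nat \<Rightarrow> 'w \<Rightarrow> real ^ 'p::finite"
    and \<beta> \<beta>hat :: "real \<Rightarrow> real ^ 'p"
    and lam :: real
    and \<omega> :: 'w
  assumes "prob_space M"
    and "compact U" and "U \<subseteq> {0<..<1}"
    and "n \<ge> 1"
    and "\<And>i. i \<in> {1..n} \<Longrightarrow> y i \<in> borel_measurable M"
    and "\<And>i. i \<in> {1..n} \<Longrightarrow> x i \<in> borel_measurable M"
    and "\<And>i u. i \<in> {1..n} \<Longrightarrow> u \<in> U \<Longrightarrow> is_cond_quantile M (x i) (y i) u (\<lambda>z. z \<bullet> \<beta> u)"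
    and "\<omega> \<in> space M"
    and "\<And>u. u \<in> U \<Longrightarrow> is_l1_qr_estimate n (\<lambda>i. y i \<omega>) (\<lambda>i. x i \<omega>) lam u (\<beta>hat u)"
  shows "(min_signal U \<beta> > sup_error U \<beta>hat \<beta> \<longrightarrow>
            (\<forall>u\<in>U. support (\<beta> u) \<subseteq> support (\<beta>hat u))) \<and>
         (\<forall>\<gamma>::real. \<gamma> \<ge> 0 \<longrightarrow>
            sup_error U \<beta>hat \<beta> < ereal \<gamma> \<longrightarrow>
            ereal \<gamma> < min_signal U \<beta> - sup_error U \<beta>hat \<beta> \<longrightarrow>
            (\<forall>u\<in>U. support (hard_threshold \<gamma> (\<beta>hat u)) = support (\<beta> u)))"
  using support_subset_support_estimate support_hard_threshold_estimate by blast

end
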